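(* Let $d\ge1$, let $\mathbb{F}$ be a field with $|\mathbb{F}|>d$, and let $S\subseteq\mathbb{F}$ with $|S|>d$. Let $f\in\mathbb{F}_{\bar{A},\bar{C}}[x_1,\ldots,x_n]$ be a non-zero polynomial of degree $\le d$, given as a black box with query access to evaluations of $f$ on elements of $\mathbb{A}_d$. Sample $b_1,\ldots,b_n\in\mathbb{A}_d$ by picking each of the $d(d+1)^2+1$ coordinates of each $b_i$ uniformly and independently from $S$. Then $$\Pr_{b_1,\ldots,b_n\in\mathbb{A}_d}[f(b_1,\ldots,b_n)=0]\le d/|S|.$$
   Context: $\mathbb{F}_{\bar{A},\bar{C}}[X]$ is the noncommutative, nonassociative polynomial algebra: basis the monomial $1$ and rooted full binary trees (with designated left/right children) whose leaves are labeled by variables; the product of monomials $m_1,m_2$ is the tree with left subtree $m_1$ and right subtree $m_2$, extended bilinearly; degree = number of leaves. Let $\mathbb{A}'_d=\mathbb{F}^{d(d+1)^2}$ with elements indexed $x[i,j,k]$, $1\le i,j\le d+1$, $1\le k\le d$, and product $z=x\circ y$ with $z[i,j,d]=0$, $z[i,j,k]=\sum_{l=1}^{d+1}x[i,l,k+1]y[l,j,k+1]$ for $1\le k\le d-1$. Let $\mathbb{A}_d=\{(a,\alpha):a\in\mathbb{A}'_d,\alpha\in\mathbb{F}\}\cong\mathbb{F}^{d(d+1)^2+1}$ with product $(a_1,\alpha_1)\cdot(a_2,\alpha_2)=(a_1\circ a_2+\alpha_1a_2+\alpha_2a_1,\alpha_1\alpha_2)$. Evaluation: $f(b)=\sum_mc_mm(b)$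 for $f=\sum_mc_mm$, with $1\mapsto(\mathbf0,1)$, $x_i\mapsto b_i$, and a monomial with left subtree $m_1$, right subtree $m_2$ mapping to $m_1(b)\cdot m_2(b)$. *)

theory Defs
  imports
    "HOL-Probability.Probability"
    "HOL-Library.Poly_Mapping"
    "HOL-Library.Function_Algebras"
begin

subsection \<open>Noncommutative, nonassociative polynomials\<close>

datatype btree = Leaf nat | Node btree btree

text \<open>\<^term>\<open>None\<close> is the monomial 1; \<^term>\<open>Leaf i\<close> is the variable \<open>x\<^sub>i\<close>.\<close>

type_synonym monomial = "btree option"

fun leaves :: "btree \<Rightarrow> nat" where
  "leaves (Leaf i) = 1"
| "leaves (Node s t) = leaves s + leaves t"

fun tree_vars :: "btree \<Rightarrow> nat set" where
  "tree_vars (Leaf i) = {i}"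
| "tree_vars (Node s t) = tree_vars s \<union> tree_vars t"

fun mon_degree :: "monomial \<Rightarrow> nat" where
  "mon_degree None = 0"
| "mon_degree (Some t) = leaves t"

fun mon_vars :: "monomial \<Rightarrow> nat set" where
  "mon_vars None = {}"
| "mon_vars (Some t) = tree_vars t"

fun mon_mult :: "monomial \<Rightarrow> monomial \<Rightarrow> monomial" where
  "mon_mult None m = m"
| "mon_mult m None = m"
| "mon_mult (Some s) (Some t) = Some (Node s t)"

text \<open>Finitely supported coefficient functions. The product \<open>times\<close> of \<open>Poly_Mapping\<close>
  is not used, since it presupposes a monoid of monomials written additively.\<close>

type_synonym 'f na_poly = "monomial \<Rightarrow>\<^sub>0 'f"

definition na_mult :: "'f::field na_poly \<Rightarrow> 'f na_poly \<Rightarrow> 'f na_poly" where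
  "na_mult f g = (\<Sum>m\<in>Poly_Mapping.keys f. \<Sum>m'\<in>Poly_Mapping.keys g.
     Poly_Mapping.single (mon_mult m m') (Poly_Mapping.lookup f m * Poly_Mapping.lookup g m'))"

definition na_polys :: "nat \<Rightarrow> 'f::field na_poly set" where
  "na_polys n = {f. \<forall>m\<in>Poly_Mapping.keys f. mon_vars m \<subseteq> {1..n}}"

definition na_degree :: "'f::field na_poly \<Rightarrow> nat" where
  "na_degree f = Max (insert 0 (mon_degree ` Poly_Mapping.keys f))"


subsection \<open>The algebra \<open>\<bbbA>\<^sub>d\<close>\<close>

definition idx :: "nat \<Rightarrow> (nat \<times> nat \<times> nat) set" where
  "idx d = {1..d+1} \<times> {1..d+1} \<times> {1..d}"

text \<open>Elements of \<open>\<bbbA>'\<^sub>d\<close> are represented by functions that vanish outside of \<^term>\<open>idx d\<close>.\<close>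

type_synonym 'f alg = "(nat \<times> nat \<times> nat \<Rightarrow> 'f) \<times> 'f"

definition alg_carrier :: "nat \<Rightarrow> 'f::field alg set" where
  "alg_carrier d = {x. \<forall>p. p \<notin> idx d \<longrightarrow> fst x p = 0}"

definition circ :: "nat \<Rightarrow> (nat \<times> nat \<times> nat \<Rightarrow> 'f) \<Rightarrow> (nat \<times> nat \<times> nat \<Rightarrow> 'f)
    \<Rightarrow> (nat \<times> nat \<times> nat \<Rightarrow> 'f::field)" where
  "circ d x y = (\<lambda>(i, j, k).
     if (i, j, k) \<in> idx d \<and> k < d then \<Sum>l=1..d+1. x (i, l, k+1) * y (l, j, k+1) else 0)"

definition alg_scale :: "'f::field \<Rightarrow> 'f alg \<Rightarrow> 'f alg" where
  "alg_scale c x = ((\<lambda>p. c * fst x p), c * snd x)"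

definition alg_mult :: "nat \<Rightarrow> 'f::field alg \<Rightarrow> 'f alg \<Rightarrow> 'f alg" where
  "alg_mult d x y =
     ((\<lambda>p. circ d (fst x) (fst y) p + snd x * fst y p + snd y * fst x p), snd x * snd y)"


subsection \<open>Evaluation\<close>

fun eval_tree :: "nat \<Rightarrow> (nat \<Rightarrow> 'f::field alg) \<Rightarrow> btree \<Rightarrow> 'f alg" where
  "eval_tree d b (Leaf i) = b i"
| "eval_tree d b (Node s t) = alg_mult d (eval_tree d b s) (eval_tree d b t)"

fun eval_mon :: "nat \<Rightarrow> (nat \<Rightarrow> 'f::field alg) \<Rightarrow> monomial \<Rightarrow> 'f alg" where
  "eval_mon d b None = (0, 1)"
| "eval_mon d b (Some t) = eval_tree d b t"

definition eval :: "nat \<Rightarrow> (nat \<Rightarrow> 'f::field alg) \<Rightarrow> 'f na_poly \<Rightarrow> 'f alg" where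
  "eval d b f =
     (\<Sum>m\<in>Poly_Mapping.keys f. alg_scale (Poly_Mapping.lookup f m) (eval_mon d b m))"


subsection \<open>Sampling\<close>

text \<open>The second argument of \<^const>\<open>Pi_pmf\<close> is the value taken outside of the index set.\<close>

definition sample_alg :: "nat \<Rightarrow> 'f::field set \<Rightarrow> 'f alg pmf" where
  "sample_alg d S = pair_pmf (Pi_pmf (idx d) 0 (\<lambda>_. pmf_of_set S)) (pmf_of_set S)"

definition sample_tuple :: "nat \<Rightarrow> nat \<Rightarrow> 'f::field set \<Rightarrow> (nat \<Rightarrow> 'f alg) pmf" where
  "sample_tuple n d S = Pi_pmf {1..n} 0 (\<lambda>_. sample_alg d S)"


subsection \<open>Consistency of the representation\<close>

lemma finite_idx: "finite (idx d)"
  by (simp add: idx_def)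

lemma card_idx: "card (idx d) = d * (d + 1)\<^sup>2"
  by (simp add: idx_def card_cartesian_product power2_eq_square algebra_simps)

lemma set_sample_alg:
  assumes "finite S" "S \<noteq> {}"
  shows "set_pmf (sample_alg d S) =
    {x \<in> alg_carrier d. (\<forall>p\<in>idx d. fst x p \<in> S) \<and> snd x \<in> S}"
  using assms
  by (auto simp: sample_alg_def alg_carrier_def set_Pi_pmf finite_idx PiE_dflt_def)

lemma alg_carrier_closed:
  "0 \<in> alg_carrier d" "(0, 1) \<in> alg_carrier d"
  "x \<in> alg_carrier d \<Longrightarrow> alg_scale c x \<in> alg_carrier d"
  "x \<in> alg_carrier d \<Longrightarrow> y \<in> alg_carrier d \<Longrightarrow> x + y \<in> alg_carrier d"
  "x \<in> alg_carrier d \<Longrightarrow> y \<in> alg_carrier d \<Longrightarrow> alg_mult d x y \<in> alg_carrier d"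
  by (auto simp: alg_carrier_def alg_scale_def alg_mult_def circ_def)

lemma alg_mult_one:
  "alg_mult d (0, 1) x = x" "alg_mult d x (0, 1) = x"
  by (auto simp: alg_mult_def circ_def fun_eq_iff prod_eq_iff)

lemma circ_bilinear:
  "circ d 0 y = 0" "circ d x 0 = 0"
  "circ d (x + x') y = circ d x y + circ d x' y"
  "circ d x (y + y') = circ d x y + circ d x y'"
  "circ d (\<lambda>p. c * x p) y = (\<lambda>p. c * circ d x y p)"
  "circ d x (\<lambda>p. c * y p) = (\<lambda>p. c * circ d x y p)"
  by (auto simp: circ_def fun_eq_iff algebra_simps sum.distrib sum_distrib_left
      simp del: sum.cl_ivl_Suc)

lemma alg_mult_bilinear:
  "alg_mult d 0 y = 0" "alg_mult d x 0 = 0"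
  "alg_mult d (x + x') y = alg_mult d x y + alg_mult d x' y"
  "alg_mult d x (y + y') = alg_mult d x y + alg_mult d x y'"
  "alg_mult d (alg_scale c x) y = alg_scale c (alg_mult d x y)"
  "alg_mult d x (alg_scale c y) = alg_scale c (alg_mult d x y)"
  by (auto simp: alg_mult_def alg_scale_def circ_bilinear fun_eq_iff prod_eq_iff algebra_simps)

lemma eval_mon_mult:
  "eval_mon d b (mon_mult m m') = alg_mult d (eval_mon d b m) (eval_mon d b m')"
  by (cases "(m, m')" rule: mon_mult.cases) (simp_all add: alg_mult_one)

lemma alg_scale_add: "alg_scale (c + c') x = alg_scale c x + alg_scale c' x"
  and alg_scale_zero: "alg_scale 0 x = 0"
  and alg_scale_scale: "alg_scale c (alg_scale c' x) = alg_scale (c * c') x"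
  by (auto simp: alg_scale_def fun_eq_iff prod_eq_iff algebra_simps)

lemma eval_superset:
  assumes "finite K" "Poly_Mapping.keys f \<subseteq> K"
  shows "eval d b f = (\<Sum>m\<in>K. alg_scale (Poly_Mapping.lookup f m) (eval_mon d b m))"
  unfolding eval_def using assms
  by (intro sum.mono_neutral_left) (auto simp: in_keys_iff alg_scale_zero)

lemma eval_add: "eval d b (f + g) = eval d b f + eval d b g"
proof -
  let ?K = "Poly_Mapping.keys f \<union> Poly_Mapping.keys g"
  have K: "finite ?K" by simp
  show ?thesis
    using Poly_Mapping.keys_add[of f g]
    by (simp add: eval_superset[OF K] lookup_add alg_scale_add sum.distrib)
qed

lemma eval_zero: "eval d b 0 = 0"
  by (simp add: eval_def)

lemma eval_single: "eval d b (Poly_Mapping.single m c) = alg_scale c (eval_mon d b m)"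
  by (subst eval_superset[of "{m}"]) auto

lemma eval_sum: "eval d b (\<Sum>i\<in>I. F i) = (\<Sum>i\<in>I. eval d b (F i))"
  by (induction I rule: infinite_finite_induct) (simp_all add: eval_zero eval_add)

lemma alg_mult_sum:
  "alg_mult d (\<Sum>i\<in>I. F i) y = (\<Sum>i\<in>I. alg_mult d (F i) y)"
  "alg_mult d y (\<Sum>i\<in>I. F i) = (\<Sum>i\<in>I. alg_mult d y (F i))"
  by (induction I rule: infinite_finite_induct) (simp_all add: alg_mult_bilinear)

lemma eval_na_mult: "eval d b (na_mult f g) = alg_mult d (eval d b f) (eval d b g)"
proof -
  have "eval d b (na_mult f g) = (\<Sum>m\<in>Poly_Mapping.keys f. \<Sum>m'\<in>Poly_Mapping.keys g.
      alg_mult d (alg_scale (Poly_Mapping.lookup f m) (eval_mon d b m))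
        (alg_scale (Poly_Mapping.lookup g m') (eval_mon d b m')))"
    by (simp add: na_mult_def eval_sum eval_single eval_mon_mult alg_mult_bilinear alg_scale_scale
        mult.commute)
  also have "\<dots> = alg_mult d (eval d b f) (eval d b g)"
    unfolding eval_def by (simp only: alg_mult_sum) (rule sum.swap)
  finally show ?thesis .
qed

end

(* A full binary tree is determined by the left-to-right sequence of its leaves, each recorded with
   its depth. The third index of an entry of an element of the algebra tracks depth, so the entry
   (1, D + 1, 1) of the value of a tree with D leaves sums, over paths 1 = v_0, ..., v_D = D + 1,
   products whose t-th factor is the entry (v_(t-1), v_t, 1 + depth of the t-th leaf) of the point
   substituted for that leaf. A suitable 0/1 point, supported on the path 1, 2, ..., D + 1, isolates
   a single tree; hence this entry of f is a polynomial function of degree at most d that is not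
   identically zero, and the Schwartz--Zippel bound applies. *)
theory Submission
  imports Defs "HOL-Computational_Algebra.Polynomial"
begin

subsection \<open>Polynomial functions and the Schwartz--Zippel bound\<close>

text \<open>These are functions, not formal polynomials: over a finite field one function has many
  representations, and \<open>D\<close> bounds the total degree of one of them. Adding one monomial
  at a time provides the induction for the closure properties.\<close>

inductive_set poly_fun :: "'v set \<Rightarrow> nat \<Rightarrow> (('v \<Rightarrow> 'f::field) \<Rightarrow> 'f) set"
  for V :: "'v set" and D :: nat where
  zero: "(\<lambda>v. 0) \<in> poly_fun V D"
| add_monom: "P \<in> poly_fun V D \<Longrightarrow> (\<Sum>x\<in>V. e x) \<le> D \<Longrightarrow>
    (\<lambda>v. c * (\<Prod>x\<in>V. v x ^ e x) + P v) \<in> poly_fun V D"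

lemma poly_fun_cong:
  assumes "P \<in> poly_fun V D" "\<And>x. x \<in> V \<Longrightarrow> v x = w x"
  shows "P v = P w"
  using assms(1)
proof induction
  case (add_monom P e c)
  have "(\<Prod>x\<in>V. v x ^ e x) = (\<Prod>x\<in>V. w x ^ e x)"
    by (intro prod.cong) (auto simp: assms(2))
  then show ?case using add_monom.IH by simp
qed simp

lemma poly_fun_monom:
  "(\<Sum>x\<in>V. e x) \<le> D \<Longrightarrow> (\<lambda>v. c * (\<Prod>x\<in>V. v x ^ e x)) \<in> poly_fun V D"
  using poly_fun.add_monom[OF poly_fun.zero, of e V D c] by simp

lemma poly_fun_const: "(\<lambda>v. c) \<in> poly_fun V D"
  using poly_fun_monom[of "\<lambda>_. 0" V D c] by simp

lemma poly_fun_coord: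
  assumes "finite V" "x \<in> V" "1 \<le> D"
  shows "(\<lambda>v. v x) \<in> poly_fun V D"
proof -
  have "(\<Prod>y\<in>V. v y ^ (if y = x then 1 else 0)) = v x" for v :: "'a \<Rightarrow> 'b"
    using assms by (subst prod.remove[of V x]) auto
  then show ?thesis
    using poly_fun_monom[of "\<lambda>y. if y = x then 1 else 0" V D "1::'b"] assms by simp
qed

lemma poly_fun_add:
  assumes "P \<in> poly_fun V D" "Q \<in> poly_fun V D"
  shows "(\<lambda>v. P v + Q v) \<in> poly_fun V D"
  using assms(1)
proof induction
  case (add_monom P e c)
  then show ?case
    using poly_fun.add_monom[OF add_monom.IH add_monom.hyps(2), of c] by (simp add: add.assoc)
qed (simp add: assms)

lemma poly_fun_sum:
  "(\<And>i. i \<in> I \<Longrightarrow> P i \<in> poly_fun V D) \<Longrightarrow> (\<lambda>v. \<Sum>i\<in>I. P i v) \<in> poly_fun V D"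
  by (induction I rule: infinite_finite_induct) (auto intro: poly_fun_const poly_fun_add)

lemma poly_fun_mono:
  assumes "P \<in> poly_fun V D" "D \<le> D'"
  shows "P \<in> poly_fun V D'"
  using assms(1)
  by induction (use assms(2) in \<open>auto intro: poly_fun.intros\<close>)

lemma poly_fun_monom_mult:
  assumes "(\<Sum>x\<in>V. e x) \<le> D" "Q \<in> poly_fun V D'"
  shows "(\<lambda>v. (c * (\<Prod>x\<in>V. v x ^ e x)) * Q v) \<in> poly_fun V (D + D')"
  using assms(2)
proof induction
  case zero
  show ?case by (simp add: poly_fun.zero)
next
  case (add_monom Q e' c')
  have "(\<Sum>x\<in>V. e x + e' x) \<le> D + D'"
    using assms(1) add_monom.hyps by (simp add: sum.distrib)
  from poly_fun.add_monom[OF add_monom.IH this, of "c * c'"]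
  show ?case by (simp add: power_add prod.distrib algebra_simps)
qed

lemma poly_fun_mult:
  assumes "P \<in> poly_fun V D" "Q \<in> poly_fun V D'"
  shows "(\<lambda>v. P v * Q v) \<in> poly_fun V (D + D')"
  using assms(1)
proof induction
  case zero
  show ?case by (simp add: poly_fun.zero)
next
  case (add_monom P e c)
  from poly_fun_add[OF poly_fun_monom_mult[OF add_monom.hyps(2) assms(2), of c] add_monom.IH]
  show ?case by (simp add: distrib_right)
qed

lemma poly_fun_cmult:
  assumes "P \<in> poly_fun V D"
  shows "(\<lambda>v. c * P v) \<in> poly_fun V D"
  using poly_fun_mult[OF poly_fun_const[of c V 0] assms] by simp

text \<open>Collecting the monomials by their power of \<open>x\<close> turns \<open>P\<close> into
  a polynomial in \<open>x\<close>. The coefficient of the \<open>k\<close>-th power loses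
  \<open>k\<close> from the degree budget, which drives the induction on the number of
  variables.\<close>

lemma poly_fun_insert:
  assumes "P \<in> poly_fun (insert x V) D" "finite V" "x \<notin> V"
  obtains Q where "\<And>k. k \<le> D \<Longrightarrow> Q k \<in> poly_fun V (D - k)"
    and "\<And>v. P v = (\<Sum>k\<le>D. v x ^ k * Q k v)"
proof -
  from assms(1)
  have "\<exists>Q. (\<forall>k\<le>D. Q k \<in> poly_fun V (D - k)) \<and> (\<forall>v. P v = (\<Sum>k\<le>D. v x ^ k * Q k v))"
  proof induction
    case zero
    show ?case by (intro exI[of _ "\<lambda>_ _. 0"]) (auto intro: poly_fun.zero)
  next
    case (add_monom P e c)
    then obtain Q where Q: "\<And>k. k \<le> D \<Longrightarrow> Q k \<in> poly_fun V (D - k)"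
      and P: "\<And>v. P v = (\<Sum>k\<le>D. v x ^ k * Q k v)" by blast
    have e: "e x + (\<Sum>y\<in>V. e y) \<le> D"
      using add_monom.hyps assms by simp
    define m where "m v = c * (\<Prod>y\<in>V. v y ^ e y)" for v
    have m: "m \<in> poly_fun V (D - e x)"
      unfolding m_def using e by (intro poly_fun_monom) simp
    \<comment> \<open>The new monomial contributes its \<open>x\<close>-free part \<open>m\<close>
      to the coefficient of the power \<open>e x\<close> only.\<close>
    define R where "R k v = (if k = e x then m v else 0) + Q k v" for k v
    have "R k \<in> poly_fun V (D - k)" if "k \<le> D" for k
      using poly_fun_add[OF m, of "Q k"] Q[OF that] by (cases "k = e x") (auto simp: R_def[abs_def])
    moreover have "c * (\<Prod>y\<in>insert x V. v y ^ e y) + P v = (\<Sum>k\<le>D. v x ^ k * R k v)" for v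
    proof -
      have "(\<Sum>k\<le>D. v x ^ k * (if k = e x then m v else 0)) =
          (\<Sum>k\<le>D. if k = e x then v x ^ e x * m v else 0)"
        by (intro sum.cong) auto
      also have "\<dots> = v x ^ e x * m v"
        using e by simp
      finally show ?thesis
        using assms by (simp add: R_def P m_def distrib_left sum.distrib)
    qed
    ultimately show ?case by blast
  qed
  then show thesis using that by blast
qed

text \<open>The sum is a polynomial in \<open>s\<close> with leading index \<open>K\<close>, so it
  has at most \<open>K\<close> roots. A bound by \<open>K\<close> rather than \<open>D\<close> is
  essential below, where \<open>K\<close> roots are traded against a leading coefficient of degree
  \<open>D - K\<close>.\<close>

lemma card_roots_le:
  fixes c :: "nat \<Rightarrow> 'f::field"
  assumes "c K \<noteq> 0" "K \<le> D" "\<And>k. K < k \<Longrightarrow> k \<le> D \<Longrightarrow> c k = 0"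
  shows "card {s \<in> S. (\<Sum>k\<le>D. s ^ k * c k) = 0} \<le> K"
proof -
  define p where "p = (\<Sum>k\<le>D. monom (c k) k)"
  have coeff: "coeff p k = (if k \<le> D then c k else 0)" for k
    by (simp add: p_def coeff_sum)
  have "p \<noteq> 0"
    using coeff[of K] assms by auto
  have "degree p \<le> K"
    by (intro degree_le) (auto simp: coeff assms(3))
  have "{s \<in> S. (\<Sum>k\<le>D. s ^ k * c k) = 0} \<subseteq> {s. poly p s = 0}"
    by (auto simp: p_def poly_sum poly_monom mult.commute)
  then have "card {s \<in> S. (\<Sum>k\<le>D. s ^ k * c k) = 0} \<le> card {s. poly p s = 0}"
    using \<open>p \<noteq> 0\<close> by (intro card_mono poly_roots_finite)
  also have "\<dots> \<le> degree p"
    using \<open>p \<noteq> 0\<close> by (rule card_poly_roots_bound)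
  finally show ?thesis using \<open>degree p \<le> K\<close> by simp
qed

text \<open>Induction on the variables: either the leading coefficient in \<open>x\<close> vanishes,
  which the induction hypothesis makes rare, or at most \<open>K\<close> values of \<open>x\<close>
  are roots. The bound is multiplied out to stay in the natural numbers, and the witness
  \<open>v\<^sub>0\<close> may lie outside the grid.\<close>

lemma schwartz_zippel:
  fixes S :: "'f::field set"
  assumes "finite V" "finite S" "P \<in> poly_fun V D" "P v\<^sub>0 \<noteq> 0"
  shows "card {v \<in> PiE_dflt V z (\<lambda>_. S). P v = 0} * card S \<le> D * card (PiE_dflt V z (\<lambda>_. S))"
  using assms(1,3,4)
proof (induction V arbitrary: P D v\<^sub>0 rule: finite_induct)
  case empty
  have "P v = P v\<^sub>0" for v
    by (rule poly_fun_cong[OF empty.prems(1)]) simp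
  with empty.prems have "P v \<noteq> 0" for v by metis
  then show ?case by simp
next
  case (insert x V)
  obtain Q where Q: "\<And>k. k \<le> D \<Longrightarrow> Q k \<in> poly_fun V (D - k)"
    and P: "\<And>v. P v = (\<Sum>k\<le>D. v x ^ k * Q k v)"
    using poly_fun_insert[OF insert.prems(1) insert.hyps(1,2)] by blast
  define I where "I = {k. k \<le> D \<and> (\<exists>v. Q k v \<noteq> 0)}"
  have "finite I" by (simp add: I_def)
  have "I \<noteq> {}"
    using insert.prems(2) unfolding P I_def by (force intro: sum.neutral)
  \<comment> \<open>\<open>K\<close> is the largest power of \<open>x\<close> whose coefficient is
    not the zero function.\<close>
  define K where "K = Max I"
  have "K \<in> I" using \<open>finite I\<close> \<open>I \<noteq> {}\<close> by (simp add: K_def)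
  then obtain w where K: "K \<le> D" and w: "Q K w \<noteq> 0" by (auto simp: I_def)
  have top: "Q k v = 0" if "K < k" "k \<le> D" for k v
  proof (rule ccontr)
    assume "Q k v \<noteq> 0"
    then have "k \<in> I" using that by (auto simp: I_def)
    then show False using Max_ge[OF \<open>finite I\<close>, of k] that by (simp add: K_def)
  qed
  let ?E = "PiE_dflt V z (\<lambda>_. S)" and ?E' = "PiE_dflt (insert x V) z (\<lambda>_. S)"
  let ?Z = "{v \<in> ?E. Q K v = 0}" and ?Z' = "{v \<in> ?E'. P v = 0}"
  \<comment> \<open>The zeros of \<open>P\<close> are counted fibrewise: \<open>R v\<close> is the
    fibre over the point \<open>v\<close> of the smaller grid.\<close>
  define R where "R v = {s \<in> S. P (v(x := s)) = 0}" for v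
  have fin: "finite ?E" using insert.hyps assms(2) by (intro finite_PiE_dflt) auto
  have finR: "finite (R v)" for v using assms(2) by (simp add: R_def)
  have cardE': "card ?E' = card S * card ?E"
    using insert.hyps assms(2) by (simp add: card_PiE_dflt)
  have Q_upd: "Q k (v(x := s)) = Q k v" if "k \<le> D" for k v s
    using insert.hyps by (intro poly_fun_cong[OF Q[OF that]]) auto
  have R_le: "card (R v) \<le> (if Q K v = 0 then card S else 0) + K" for v
  proof (cases "Q K v = 0")
    case True
    have "card (R v) \<le> card S"
      using assms(2) by (intro card_mono) (auto simp: R_def)
    then show ?thesis using True by simp
  next
    case False
    have "P (v(x := s)) = (\<Sum>k\<le>D. s ^ k * Q k v)" for s
      unfolding P by (rule sum.cong) (simp_all add: Q_upd)
    then have "R v = {s \<in> S. (\<Sum>k\<le>D. s ^ k * Q k v) = 0}"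
      by (simp add: R_def)
    then show ?thesis using card_roots_le[of "\<lambda>k. Q k v" K D S] K False top by simp
  qed
  have "?Z' \<subseteq> (\<lambda>(v, s). v(x := s)) ` (SIGMA v:?E. R v)"
  proof
    fix v assume v: "v \<in> ?Z'"
    \<comment> \<open>Points of \<open>?E\<close> take the default value \<open>z\<close> off
      \<open>V\<close>, so coordinate \<open>x\<close> has to be reset to \<open>z\<close>.\<close>
    have "(v(x := z), v x) \<in> (SIGMA v:?E. R v)"
      using v insert.hyps by (auto simp: PiE_dflt_def R_def)
    then show "v \<in> (\<lambda>(v, s). v(x := s)) ` (SIGMA v:?E. R v)"
      by (rule rev_image_eqI) simp
  qed
  then have "card ?Z' \<le> card (SIGMA v:?E. R v)"
    using fin finR by (intro surj_card_le) auto
  also have "\<dots> = (\<Sum>v\<in>?E. card (R v))"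
    using fin finR by simp
  also have "\<dots> \<le> (\<Sum>v\<in>?E. (if Q K v = 0 then card S else 0) + K)"
    by (intro sum_mono R_le)
  also have "\<dots> = card ?Z * card S + K * card ?E"
    using fin by (simp add: sum.distrib flip: sum.inter_filter)
  also have "\<dots> \<le> (D - K) * card ?E + K * card ?E"
    using insert.IH[OF Q[OF K] w] by simp
  also have "\<dots> = D * card ?E"
    using K by (simp flip: distrib_right)
  finally show ?case
    unfolding cardE' by (simp add: mult.left_commute mult.commute)
qed


subsection \<open>Coding trees by leaf depths\<close>

text \<open>\<open>k\<close> is the depth assigned to the root, so a subtree is coded with its
  depths in the whole tree.\<close>

fun leaf_code :: "nat \<Rightarrow> btree \<Rightarrow> (nat \<times> nat) list" where
  "leaf_code k (Leaf i) = [(i, k)]"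
| "leaf_code k (Node s t) = leaf_code (k + 1) s @ leaf_code (k + 1) t"

lemma length_leaf_code [simp]: "length (leaf_code k t) = leaves t"
  by (induction t arbitrary: k) auto

lemma leaves_pos: "0 < leaves t"
  by (induction t) auto

lemma leaf_code_bounds:
  "(i, l) \<in> set (leaf_code k t) \<Longrightarrow> i \<in> tree_vars t \<and> k \<le> l \<and> l < k + leaves t"
proof (induction t arbitrary: k)
  case (Node s t)
  then show ?case using leaves_pos[of s] leaves_pos[of t] by fastforce
qed auto

lemma leaf_code_ne_Nil: "leaf_code k t \<noteq> []"
  using leaves_pos[of t] by (metis length_0_conv length_leaf_code less_irrefl)

lemma hd_leaf_code: "k \<le> snd (hd (leaf_code k t))"
  using leaf_code_bounds[of "fst (hd (leaf_code k t))" "snd (hd (leaf_code k t))" k t]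
  by (simp add: leaf_code_ne_Nil)

text \<open>The first letter has depth \<open>k\<close> exactly when the tree is a leaf. Otherwise
  the code of the left subtree is split off first and the right one is read from the rest; the tails
  \<open>xs\<close> and \<open>ys\<close> make this recursion possible.\<close>

lemma leaf_code_prefix_free:
  "leaf_code k s @ xs = leaf_code k t @ ys \<Longrightarrow> s = t \<and> xs = ys"
proof (induction s arbitrary: k t xs ys)
  case (Leaf i)
  show ?case
  proof (cases t)
    case (Node t\<^sub>1 t\<^sub>2)
    then have "k + 1 \<le> snd (hd (leaf_code k t @ ys))"
      using hd_leaf_code[of "k + 1" t\<^sub>1] by (simp add: leaf_code_ne_Nil)
    then show ?thesis by (simp flip: Leaf)
  qed (use Leaf in simp)
next
  case (Node s\<^sub>1 s\<^sub>2)
  show ?case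
  proof (cases t)
    case (Leaf i)
    then have "snd (hd (leaf_code k (Node s\<^sub>1 s\<^sub>2) @ xs)) = k"
      using Node.prems by simp
    then show ?thesis
      using hd_leaf_code[of "k + 1" s\<^sub>1] by (simp add: leaf_code_ne_Nil)
  next
    case t: (Node t\<^sub>1 t\<^sub>2)
    then have "leaf_code (k + 1) s\<^sub>1 @ leaf_code (k + 1) s\<^sub>2 @ xs =
        leaf_code (k + 1) t\<^sub>1 @ leaf_code (k + 1) t\<^sub>2 @ ys"
      using Node.prems by simp
    from Node.IH(1)[OF this] show ?thesis using Node.IH(2) t by blast
  qed
qed

lemma leaf_code_inject: "leaf_code k s = leaf_code k t \<longleftrightarrow> s = t"
  using leaf_code_prefix_free[of k s "[]" t "[]"] by auto


subsection \<open>A point separating one tree from all others\<close>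

text \<open>All matrices are supported on the superdiagonal, so that the entry \<open>(1, D + 1, 1)\<close> of a
  product only sees the path \<open>1, 2, \<dots>, D + 1\<close>, whose \<open>a\<close>-th step is open exactly for the
  variable and the depth prescribed by the \<open>a\<close>-th letter of \<open>w\<close>.\<close>

definition path_point :: "(nat \<times> nat) list \<Rightarrow> nat \<Rightarrow> 'f::field alg" where
  "path_point w i = ((\<lambda>(a, c, k). of_bool (1 \<le> a \<and> a \<le> length w \<and> c = a + 1 \<and> w ! (a - 1) = (i, k))), 0)"

text \<open>With zero scalar parts, \<open>alg_mult\<close> reduces to \<open>circ\<close>.\<close>

lemma snd_eval_tree_path_point: "snd (eval_tree d (path_point w) t) = 0"
  by (induction t) (auto simp: path_point_def alg_mult_def)

text \<open>Starting at vertex \<open>i\<close>, the tree consumes one letter of \<open>w\<close>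
  per leaf, and the entry is 1 exactly when the letters read spell its code. The bound on
  \<open>k + leaves t\<close> keeps all depths within the third index range, so that
  \<open>circ\<close> is never cut off.\<close>

lemma fst_eval_tree_path_point:
  assumes "length w \<le> d" "i \<in> {1..d+1}" "j \<in> {1..d+1}" "1 \<le> k" "k + leaves t \<le> d + 1"
  shows "fst (eval_tree d (path_point w) t) (i, j, k) =
    (of_bool (j = i + leaves t \<and> take (leaves t) (drop (i - 1) w) = leaf_code k t) :: 'f::field)"
  using assms(2-)
proof (induction t arbitrary: i j k)
  case (Leaf x)
  have "take 1 (drop (i - 1) w) = [(x, k)] \<longleftrightarrow> i \<le> length w \<and> w ! (i - 1) = (x, k)"
    using Leaf.prems(1)
    by (cases "i - 1 < length w") (auto simp: take_Suc hd_drop_conv_nth)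
  then show ?case using Leaf.prems by (auto simp: path_point_def)
next
  case (Node s t)
  let ?x = "fst (eval_tree d (path_point w) s) :: _ \<Rightarrow> 'f"
    and ?y = "fst (eval_tree d (path_point w) t) :: _ \<Rightarrow> 'f"
  let ?A = "take (leaves s) (drop (i - 1) w) = leaf_code (k + 1) s"
  let ?B = "\<lambda>l. j = l + leaves t \<and> take (leaves t) (drop (l - 1) w) = leaf_code (k + 1) t"
  have k: "k < d" "k + 1 + leaves s \<le> d + 1" "k + 1 + leaves t \<le> d + 1"
    using Node.prems leaves_pos[of s] leaves_pos[of t] by auto
  have "fst (eval_tree d (path_point w) (Node s t)) (i, j, k) = circ d ?x ?y (i, j, k)"
    by (simp add: alg_mult_def snd_eval_tree_path_point)
  also have "\<dots> = (\<Sum>l=1..d+1. ?x (i, l, k + 1) * ?y (l, j, k + 1))"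
    using Node.prems k by (simp add: circ_def idx_def)
  \<comment> \<open>The left subtree advances by \<open>leaves s\<close> vertices, which leaves a
    single possible midpoint.\<close>
  also have "\<dots> = (\<Sum>l=1..d+1. if l = i + leaves s then of_bool (?A \<and> ?B l) else 0)"
  proof (rule sum.cong[OF refl])
    fix l assume l: "l \<in> {1..d+1}"
    have "?x (i, l, k + 1) = of_bool (l = i + leaves s \<and> ?A)"
      using Node.IH(1)[of i l "k + 1"] Node.prems l k by simp
    moreover have "?y (l, j, k + 1) = of_bool (?B l)"
      using Node.IH(2)[of l j "k + 1"] Node.prems l k by simp
    ultimately show "?x (i, l, k + 1) * ?y (l, j, k + 1) =
        (if l = i + leaves s then of_bool (?A \<and> ?B l) else 0)" by auto
  qed
  also have "\<dots> = of_bool (i + leaves s \<le> d + 1 \<and> ?A \<and> ?B (i + leaves s))"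
    using Node.prems by (auto simp: sum.delta')
  \<comment> \<open>The range condition on the midpoint is absorbed: it is at most \<open>j\<close>,
    and \<open>j\<close> is at most \<open>d + 1\<close>.\<close>
  also have "\<dots> = of_bool (j = i + leaves (Node s t) \<and>
      take (leaves (Node s t)) (drop (i - 1) w) = leaf_code k (Node s t))"
  proof -
    have "take (leaves s + leaves t) (drop (i - 1) w) =
        take (leaves s) (drop (i - 1) w) @ take (leaves t) (drop (i + leaves s - 1) w)"
      using Node.prems(1) by (simp add: take_add add.commute)
    \<comment> \<open>If \<open>w\<close> ends too early, \<open>u\<close> is too short and both
      sides fail by length.\<close>
    moreover have "take (leaves s) (drop (i - 1) w) @ u = leaf_code (k + 1) s @ leaf_code (k + 1) t
        \<longleftrightarrow> ?A \<and> u = leaf_code (k + 1) t" if "length u \<le> leaves t" for u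
    proof (cases "length u = leaves t")
      case True
      then show ?thesis by simp
    next
      case False
      then have "length (take (leaves s) (drop (i - 1) w) @ u) < leaves s + leaves t"
        using that by simp
      then show ?thesis using False
        by (metis length_append length_leaf_code less_irrefl)
    qed
    ultimately show ?thesis using Node.prems by (auto simp: add.assoc)
  qed
  finally show ?case .
qed

text \<open>The column \<open>leaves t + 1\<close> fixes the number of leaves, so the whole code is
  compared and its injectivity applies.\<close>

lemma fst_eval_tree_path_point_top:
  assumes "leaves s \<le> d" "leaves t \<le> d"
  shows "fst (eval_tree d (path_point (leaf_code 1 t)) s) (1, leaves t + 1, 1) =
    (of_bool (s = t) :: 'f::field)"
proof -
  have "fst (eval_tree d (path_point (leaf_code 1 t)) s) (1, leaves t + 1, 1) =
    (of_bool (leaves t = leaves s \<and> take (leaves s) (leaf_code 1 t) = leaf_code 1 s) :: 'f)"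
    using fst_eval_tree_path_point[of "leaf_code 1 t" d 1 "leaves t + 1" 1 s] assms by simp
  also have "leaves t = leaves s \<and> take (leaves s) (leaf_code 1 t) = leaf_code 1 s \<longleftrightarrow> s = t"
    by (auto simp: leaf_code_inject dest: sym[of "leaves t"])
  finally show ?thesis .
qed


subsection \<open>Coordinates of the evaluation\<close>

text \<open>A flat index set for all sampled scalars: \<open>None\<close> stands for the scalar
  part, \<open>Some p\<close> for the entry \<open>p\<close>.\<close>

definition coords :: "nat \<Rightarrow> nat \<Rightarrow> (nat \<times> (nat \<times> nat \<times> nat) option) set" where
  "coords n d = {1..n} \<times> insert None (Some ` idx d)"

definition decode :: "nat \<Rightarrow> nat \<Rightarrow> (nat \<times> (nat \<times> nat \<times> nat) option \<Rightarrow> 'f) \<Rightarrow> nat \<Rightarrow> 'f::field alg" where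
  "decode n d v i = ((\<lambda>p. if (i, Some p) \<in> coords n d then v (i, Some p) else 0),
     if (i, None) \<in> coords n d then v (i, None) else 0)"

lemma finite_coords: "finite (coords n d)"
  by (simp add: coords_def finite_idx)

text \<open>Each leaf has degree 1 and the product is bilinear, so degrees add. Both components are
  treated at once because the first component of a product involves the scalar parts.\<close>

lemma poly_fun_eval_tree:
  "(\<forall>p. (\<lambda>v :: _ \<Rightarrow> 'f::field. fst (eval_tree d (decode n d v) t) p) \<in> poly_fun (coords n d) (leaves t)) \<and>
    (\<lambda>v :: _ \<Rightarrow> 'f. snd (eval_tree d (decode n d v) t)) \<in> poly_fun (coords n d) (leaves t)"
proof (induction t)
  case (Leaf i)
  have "(\<lambda>v :: _ \<Rightarrow> 'f. if (i, q) \<in> coords n d then v (i, q) else 0) \<in> poly_fun (coords n d) 1" for q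
    by (cases "(i, q) \<in> coords n d") (simp_all add: poly_fun_const poly_fun_coord finite_coords)
  then show ?case by (simp add: decode_def del: split_paired_All)
next
  case (Node s t)
  let ?x = "\<lambda>v :: _ \<Rightarrow> 'f. eval_tree d (decode n d v) s" and ?y = "\<lambda>v :: _ \<Rightarrow> 'f. eval_tree d (decode n d v) t"
  let ?F = "poly_fun (coords n d) (leaves s + leaves t)"
  have s: "(\<lambda>v. fst (?x v) p) \<in> poly_fun (coords n d) (leaves s)"
      "(\<lambda>v. snd (?x v)) \<in> poly_fun (coords n d) (leaves s)"
    and t: "(\<lambda>v. fst (?y v) p) \<in> poly_fun (coords n d) (leaves t)"
      "(\<lambda>v. snd (?y v)) \<in> poly_fun (coords n d) (leaves t)" for p
    using Node.IH by (auto simp del: split_paired_All)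
  have "(\<lambda>v. circ d (fst (?x v)) (fst (?y v)) p) \<in> ?F" for p
  proof -
    obtain i j k where p: "p = (i, j, k)" by (cases p)
    show ?thesis
    proof (cases "(i, j, k) \<in> idx d \<and> k < d")
      case True
      have "(\<lambda>v. \<Sum>l=1..d+1. fst (?x v) (i, l, k + 1) * fst (?y v) (l, j, k + 1)) \<in> ?F"
        by (rule poly_fun_sum) (rule poly_fun_mult[OF s(1) t(1)])
      with True show ?thesis by (simp add: circ_def p del: sum.cl_ivl_Suc)
    next
      case False
      then have "circ d x y p = 0" for x y :: "nat \<times> nat \<times> nat \<Rightarrow> 'f"
        unfolding circ_def p by auto
      then show ?thesis by (simp add: poly_fun_const)
    qed
  qed
  moreover have "(\<lambda>v. snd (?y v) * fst (?x v) p) \<in> ?F" for p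
    using poly_fun_mult[OF t(2) s(1)] by (simp add: add.commute)
  ultimately show ?case
    using poly_fun_mult[OF s(2) t(1)] poly_fun_mult[OF s(2) t(2)]
    by (simp add: alg_mult_def poly_fun_add del: split_paired_All)
qed

lemma sum_apply: "(\<Sum>i\<in>I. F i) x = (\<Sum>i\<in>I. F i x)"
  by (induction I rule: infinite_finite_induct) auto

lemma fst_eval:
  "fst (eval d b f) p =
     (\<Sum>m\<in>Poly_Mapping.keys f. Poly_Mapping.lookup f m * fst (eval_mon d b m) p)"
  by (simp add: eval_def fst_sum sum_apply alg_scale_def)

lemma snd_eval:
  "snd (eval d b f) =
     (\<Sum>m\<in>Poly_Mapping.keys f. Poly_Mapping.lookup f m * snd (eval_mon d b m))"
  by (simp add: eval_def snd_sum alg_scale_def)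

lemma mon_degree_le_na_degree: "m \<in> Poly_Mapping.keys f \<Longrightarrow> mon_degree m \<le> na_degree f"
  by (auto simp: na_degree_def intro!: Max_ge)

lemma poly_fun_eval:
  fixes f :: "'f::field na_poly"
  assumes "na_degree f \<le> d"
  shows "(\<lambda>v. fst (eval d (decode n d v) f) p) \<in> poly_fun (coords n d) d"
proof -
  have "(\<lambda>v :: _ \<Rightarrow> 'f. fst (eval_mon d (decode n d v) m) p) \<in> poly_fun (coords n d) d"
    if "m \<in> Poly_Mapping.keys f" for m
  proof (cases m)
    case (Some t)
    then have "leaves t \<le> d" using mon_degree_le_na_degree[OF that] assms by simp
    moreover have "(\<lambda>v :: _ \<Rightarrow> 'f. fst (eval_tree d (decode n d v) t) p) \<in> poly_fun (coords n d) (leaves t)"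
      using poly_fun_eval_tree by blast
    ultimately have "(\<lambda>v :: _ \<Rightarrow> 'f. fst (eval_tree d (decode n d v) t) p) \<in> poly_fun (coords n d) d"
      by (rule poly_fun_mono[rotated])
    then show ?thesis using Some by simp
  qed (simp add: poly_fun_const)
  then show ?thesis
    unfolding fst_eval by (intro poly_fun_sum poly_fun_cmult)
qed

text \<open>The separating point has to be a value of \<open>decode\<close> to serve as a witness of
  non-vanishing. Its support fits because row, column and depth are bounded through the number of
  leaves.\<close>

lemma path_point_eq_decode:
  assumes "tree_vars t \<subseteq> {1..n}" "leaves t \<le> d"
  obtains v where "decode n d v = (path_point (leaf_code 1 t) :: nat \<Rightarrow> 'f::field alg)"
proof
  let ?b = "path_point (leaf_code 1 t) :: nat \<Rightarrow> 'f alg"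
  define v where "v = (\<lambda>(i, q). case q of None \<Rightarrow> snd (?b i) | Some p \<Rightarrow> fst (?b i) p)"
  have zero: "fst (?b i) p = 0" if "(i, Some p) \<notin> coords n d" for i p
  proof (rule ccontr)
    obtain a c k where p: "p = (a, c, k)" by (cases p)
    assume "fst (?b i) p \<noteq> 0"
    then have a: "1 \<le> a" "a \<le> leaves t" "c = a + 1" "leaf_code 1 t ! (a - 1) = (i, k)"
      by (auto simp: path_point_def p split: if_splits)
    then have "(i, k) \<in> set (leaf_code 1 t)"
      by (metis One_nat_def Suc_le_eq diff_Suc_less length_leaf_code less_le_trans nth_mem)
    from leaf_code_bounds[OF this] have "(i, Some p) \<in> coords n d"
      using a assms by (auto simp: coords_def idx_def p)
    with that show False by contradiction
  qed
  show "decode n d v = ?b"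
  proof (rule ext, rule prod_eqI)
    show "fst (decode n d v i) = fst (?b i)" for i
      by (rule ext) (simp add: decode_def v_def zero del: One_nat_def)
    show "snd (decode n d v i) = snd (?b i)" for i
      by (simp add: decode_def v_def path_point_def)
  qed
qed


subsection \<open>The sampling distribution\<close>

lemma pair_pmf_of_set:
  assumes "finite A" "A \<noteq> {}" "finite B" "B \<noteq> {}"
  shows "pair_pmf (pmf_of_set A) (pmf_of_set B) = pmf_of_set (A \<times> B)"
proof (rule pmf_eqI)
  fix x :: "'a \<times> 'b"
  show "pmf (pair_pmf (pmf_of_set A) (pmf_of_set B)) x = pmf (pmf_of_set (A \<times> B)) x"
    using assms by (cases x) (simp add: pmf_pair card_cartesian_product indicator_def)
qed

text \<open>Independent uniform choices are uniform on the product set, and \<open>decode\<close> is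
  a bijection from the flat grid onto the nested one, with matching default values 0.\<close>

lemma sample_tuple_eq_map_decode:
  assumes "finite S" "S \<noteq> {}"
  shows "sample_tuple n d S = map_pmf (decode n d) (pmf_of_set (PiE_dflt (coords n d) 0 (\<lambda>_. S)))"
proof -
  let ?E = "PiE_dflt (coords n d) 0 (\<lambda>_. S)"
  let ?A = "PiE_dflt (idx d) 0 (\<lambda>_. S) \<times> S"
  let ?B = "PiE_dflt {1..n} 0 (\<lambda>_. ?A)"
  have A: "finite ?A" "?A \<noteq> {}"
    using assms by (auto intro!: finite_PiE_dflt finite_idx simp: PiE_dflt_empty_iff)
  have E: "finite ?E" "?E \<noteq> {}"
    using assms by (auto intro!: finite_PiE_dflt finite_coords simp: PiE_dflt_empty_iff)
  have dec: "decode n d v i = ((\<lambda>p. v (i, Some p)), v (i, None))" if "v \<in> ?E" for v i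
    using that by (auto simp: decode_def PiE_dflt_def)
  have "inj_on (decode n d) ?E"
  proof (rule inj_onI, rule ext)
    fix v w and x :: "nat \<times> (nat \<times> nat \<times> nat) option"
    assume v: "v \<in> ?E" and w: "w \<in> ?E" and eq: "decode n d v = decode n d w"
    obtain i q where x: "x = (i, q)" by (cases x)
    have "decode n d v i = decode n d w i" using eq by simp
    then show "v x = w x"
      unfolding dec[OF v] dec[OF w] x
      by (cases q) (simp_all add: fun_eq_iff del: split_paired_All)
  qed
  moreover have "decode n d ` ?E = ?B"
  proof (intro equalityI subsetI)
    fix b assume "b \<in> decode n d ` ?E"
    then obtain v where v: "v \<in> ?E" "b = decode n d v" by auto
    have "b i = ((\<lambda>p. v (i, Some p)), v (i, None))" for i
      using v dec by simp
    moreover have "v (i, Some p) \<in> S" if "i \<in> {1..n}" "p \<in> idx d" for i p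
      using v(1) that by (auto simp: PiE_dflt_def coords_def)
    moreover have "v (i, Some p) = 0" if "i \<notin> {1..n} \<or> p \<notin> idx d" for i p
    proof -
      have "(i, Some p) \<notin> coords n d" using that by (auto simp: coords_def)
      then show ?thesis using v(1) by (simp add: PiE_dflt_def)
    qed
    moreover have "v (i, None) \<in> S" if "i \<in> {1..n}" for i
      using v(1) that by (auto simp: PiE_dflt_def coords_def)
    moreover have "v (i, None) = 0" if "i \<notin> {1..n}" for i
      using v(1) that by (auto simp: PiE_dflt_def coords_def)
    ultimately show "b \<in> ?B"
      by (simp add: PiE_dflt_def zero_prod_def zero_fun_def)
  next
    fix b assume b: "b \<in> ?B"
    define v where "v = (\<lambda>(i, q). case q of None \<Rightarrow> snd (b i) | Some p \<Rightarrow> fst (b i) p)"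
    have v: "v \<in> ?E"
    proof -
      have "v (i, q) \<in> S" if "(i, q) \<in> coords n d" for i q
      proof -
        have "b i \<in> ?A" using b that by (simp add: PiE_dflt_def coords_def)
        then show ?thesis
          using that by (cases q) (auto simp: PiE_dflt_def coords_def v_def mem_Times_iff)
      qed
      moreover have "v (i, q) = 0" if "(i, q) \<notin> coords n d" for i q
      proof (cases "i \<in> {1..n}")
        case True
        then have "b i \<in> ?A" using b by (simp add: PiE_dflt_def)
        then show ?thesis
          using True that by (cases q) (auto simp: PiE_dflt_def coords_def v_def mem_Times_iff)
      next
        case False
        then have "b i = 0" using b by (simp add: PiE_dflt_def)
        then show ?thesis by (simp add: v_def split: option.split)
      qed
      ultimately show ?thesis by (auto simp: PiE_dflt_def)
    qed
    have "decode n d v = b"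
      by (rule ext) (simp add: dec[OF v], simp add: v_def)
    then show "b \<in> decode n d ` ?E" using v by blast
  qed
  ultimately have "map_pmf (decode n d) (pmf_of_set ?E) = pmf_of_set ?B"
    using map_pmf_of_set_inj[OF _ E(2,1)] by metis
  also have "\<dots> = sample_tuple n d S"
    unfolding sample_tuple_def sample_alg_def using assms A
    by (simp add: Pi_pmf_of_set finite_idx pair_pmf_of_set finite_PiE_dflt PiE_dflt_empty_iff)
  finally show ?thesis by simp
qed


subsection \<open>Bounding the vanishing probability\<close>

theorem mainTheorem8:
  fixes S :: "'f::field set" and f :: "'f na_poly" and d n :: nat
  assumes "d \<ge> 1"
    and "finite (UNIV :: 'f set) \<longrightarrow> card (UNIV :: 'f set) > d"
    and "finite S" and "card S > d"
    and "f \<in> na_polys n" and "f \<noteq> 0" and "na_degree f \<le> d"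
  shows "measure_pmf.prob (sample_tuple n d S) {b. eval d b f = 0} \<le> real d / real (card S)"
proof -
  let ?E = "PiE_dflt (coords n d) 0 (\<lambda>_. S)"
  have S: "finite S" "S \<noteq> {}" "card S > 0" using assms by auto
  have E: "finite ?E" "?E \<noteq> {}"
    using S by (auto intro!: finite_PiE_dflt finite_coords simp: PiE_dflt_empty_iff)
  show ?thesis
  \<comment> \<open>A constant polynomial has zero first component, so its scalar part, the constant
    coefficient, is used instead.\<close>
  proof (cases "Poly_Mapping.keys f \<subseteq> {None}")
    case True
    with \<open>f \<noteq> 0\<close> have "Poly_Mapping.keys f = {None}"
      by (metis keys_eq_empty subset_singletonD)
    then have "snd (eval d b f) \<noteq> 0" for b
      by (simp add: snd_eval flip: in_keys_iff)
    then have "eval d b f \<noteq> 0" for b by (metis snd_zero)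
    then show ?thesis by simp
  next
    case False
    then obtain t where t: "Some t \<in> Poly_Mapping.keys f"
      by (metis insertCI not_None_eq subsetI)
    have deg: "leaves s \<le> d" if "Some s \<in> Poly_Mapping.keys f" for s
      using mon_degree_le_na_degree[OF that] assms(7) by simp
    have "tree_vars t \<subseteq> {1..n}"
      using assms(5) t by (force simp: na_polys_def)
    then obtain v\<^sub>0 :: "_ \<Rightarrow> 'f" where v\<^sub>0: "decode n d v\<^sub>0 = path_point (leaf_code 1 t)"
      using path_point_eq_decode deg[OF t] by metis
    define P where "P v = fst (eval d (decode n d v) f) (1, leaves t + 1, 1)" for v
    have P: "P \<in> poly_fun (coords n d) d"
      unfolding P_def[abs_def] by (rule poly_fun_eval[OF assms(7)])
    \<comment> \<open>Only the coefficient of \<open>t\<close> survives: other trees vanish at this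
      point, and the monomial 1 has zero first component.\<close>
    have "P v\<^sub>0 = (\<Sum>m\<in>Poly_Mapping.keys f. if m = Some t then Poly_Mapping.lookup f m else 0)"
      unfolding P_def v\<^sub>0 fst_eval
    proof (rule sum.cong[OF refl])
      fix m assume m: "m \<in> Poly_Mapping.keys f"
      show "Poly_Mapping.lookup f m *
          fst (eval_mon d (path_point (leaf_code 1 t)) m) (1, leaves t + 1, 1) =
        (if m = Some t then Poly_Mapping.lookup f m else 0)"
        using m fst_eval_tree_path_point_top[OF deg deg[OF t], where 'f = 'f]
        by (cases m) auto
    qed
    also have "\<dots> \<noteq> 0"
      using t by (simp add: in_keys_iff)
    finally have count: "card {v \<in> ?E. P v = 0} * card S \<le> d * card ?E"
      using schwartz_zippel[OF finite_coords S(1) P] by blast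
    have "measure_pmf.prob (sample_tuple n d S) {b. eval d b f = 0} =
        measure_pmf.prob (pmf_of_set ?E) {v. eval d (decode n d v) f = 0}"
      using S by (simp add: sample_tuple_eq_map_decode vimage_def)
    \<comment> \<open>If the value of \<open>f\<close> is zero, so is its single entry
      \<open>P\<close>.\<close>
    also have "\<dots> \<le> measure_pmf.prob (pmf_of_set ?E) {v. P v = 0}"
      by (intro measure_pmf.finite_measure_mono) (auto simp: P_def)
    also have "\<dots> = real (card {v \<in> ?E. P v = 0}) / real (card ?E)"
      using E by (simp add: measure_pmf_of_set Collect_conj_eq)
    also have "\<dots> \<le> real d / real (card S)"
    proof -
      have "real (card {v \<in> ?E. P v = 0}) * real (card S) \<le> real d * real (card ?E)"
        using count by (simp flip: of_nat_mult)
      moreover have "card ?E > 0" using E by (simp add: card_gt_0_iff)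
      ultimately show ?thesis using S by (simp add: divide_simps)
    qed
    finally show ?thesis .
  qed
qed

end
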